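(* Let $N\ge 1$ be an integer, let $y\in\mathbb{R}$, and let $n\ge 0$ be an integer. The Quasi-Hermite polynomials $H_n(x,y;N)$ satisfy, as polynomials in $x$: 1) $\partial_x H_n(x,y;N)=n\left(1+\frac{y}{N}\partial_x^2\right)^N x^{n-1}=n\,H_{n-1}(x,y;N)$; 2) $H_{n+1}(x,y;N)=\left(x+\dfrac{2y\,\partial_x}{1+\frac{y}{N}\partial_x^2}\right)H_n(x,y;N)$; 3) $H_{n+1}(x,y;N)-x\,H_n(x,y;N)-2ny\,H_{n-1}(x,y;N)=\dfrac{y}{N}\,n(n-1)\left(x\,H_{n-2}(x,y;N)-H_{n-1}(x,y;N)\right)$.
   Context: For an integer $N\ge 1$, real $y$ and integer $n\ge 0$, the Quasi-Hermite polynomial is defined by $H_n(x,y;N)=\left(1+\frac{y}{N}\partial_x^2\right)^N x^n$, where $\partial_x$ is differentiation with respect to $x$. The symbol $x$ inside an operator denotes multiplication by $x$. The operator $\frac{1}{1+\frac{y}{N}\partial_x^2}$ denotes the inverse of $1+\frac{y}{N}\partial_x^2$ on polynomials in $x$, i.e. $\sum_{k\ge 0}\left(-\frac{y}{N}\right)^k\partial_x^{2k}$ (a finite sum on each polynomial), and $\frac{2y\,\partial_x}{1+\frac{y}{N}\partial_x^2}=2y\,\partial_x\cdot\frac{1}{1+\frac{y}{N}\partial_x^2}$ (the two factors commute). Terms with a vanishing coefficient $n$ or $n(n-1)$ multiplying an expression of negative index or exponent are read as $0$. *)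

theory Defs
  imports Complex_Main "HOL-Computational_Algebra.Polynomial"
begin

definition qh_op :: "nat \<Rightarrow> real \<Rightarrow> real poly \<Rightarrow> real poly" where
  "qh_op N y p = p + smult (y / real N) ((pderiv ^^ 2) p)"

definition quasi_hermite :: "nat \<Rightarrow> real \<Rightarrow> nat \<Rightarrow> real poly" where
  "quasi_hermite N y n = (qh_op N y ^^ N) (monom 1 n)"

text \<open>
  The Neumann series for the inverse of \<open>qh_op N y\<close>.  The terms with \<open>k > degree p\<close> vanish,
  so truncating the series at \<open>k = degree p\<close> drops nothing; the lemmas below confirm that the
  result is a two-sided inverse on all of \<open>real poly\<close>.
\<close>

definition qh_op_inv :: "nat \<Rightarrow> real \<Rightarrow> real poly \<Rightarrow> real poly" where
  "qh_op_inv N y p = (\<Sum>k\<le>degree p. smult ((- (y / real N)) ^ k) ((pderiv ^^ (2 * k)) p))"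

lemma funpow_pderiv_eq_0: "degree p < k \<Longrightarrow> (pderiv ^^ k) p = 0" for p :: "real poly"
proof (induction k arbitrary: p)
  case (Suc k)
  show ?case
  proof (cases "degree p = 0")
    case True
    then have "pderiv p = 0" by (simp add: pderiv_eq_0_iff)
    moreover have "(pderiv ^^ k) (0 :: real poly) = 0" by (induction k) auto
    ultimately show ?thesis by (simp add: funpow_swap1 del: funpow.simps add: funpow_Suc_right)
  next
    case False
    then have "degree (pderiv p) < k" using Suc.prems by (simp add: degree_pderiv)
    then show ?thesis using Suc.IH by (simp del: funpow.simps add: funpow_Suc_right)
  qed
qed simp

lemma qh_op_inv_eq:
  assumes "degree p \<le> m"
  shows "qh_op_inv N y p = (\<Sum>k\<le>m. smult ((- (y / real N)) ^ k) ((pderiv ^^ (2 * k)) p))"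
  unfolding qh_op_inv_def using assms
  by (intro sum.mono_neutral_left) (auto simp: funpow_pderiv_eq_0)

lemma funpow_pderiv_add: "(pderiv ^^ k) (p + q) = (pderiv ^^ k) p + (pderiv ^^ k) q"
  for p q :: "real poly"
  by (induction k) (auto simp: pderiv_add)

lemma funpow_pderiv_smult: "(pderiv ^^ k) (smult c p) = smult c ((pderiv ^^ k) p)"
  for p :: "real poly"
  by (induction k) (auto simp: pderiv_smult)

lemma pderiv_sum': "pderiv (\<Sum>k\<in>A. f k) = (\<Sum>k\<in>A. pderiv (f k))" for f :: "nat \<Rightarrow> real poly"
  by (induction A rule: infinite_finite_induct) (auto simp: pderiv_add)

lemma smult_sum': "smult c (\<Sum>k\<in>A. f k) = (\<Sum>k\<in>A. smult c (f k))" for f :: "nat \<Rightarrow> real poly"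
  by (induction A rule: infinite_finite_induct) (auto simp: smult_add_right)

lemma pderiv_qh_op_inv: "pderiv (qh_op_inv N y p) = qh_op_inv N y (pderiv p)"
proof -
  have "degree (pderiv p) \<le> degree p" by (simp add: degree_pderiv)
  then show ?thesis
    by (subst qh_op_inv_eq[of "pderiv p" "degree p"])
      (simp_all add: qh_op_inv_def pderiv_sum' pderiv_smult funpow_swap1)
qed

lemma qh_op_qh_op_inv: "qh_op N y (qh_op_inv N y p) = p"
proof -
  define c where "c = - (y / real N)"
  define t where "t k = smult (c ^ k) ((pderiv ^^ (2 * k)) p)" for k
  have "qh_op_inv N y p = (\<Sum>k\<le>degree p. t k)"
    by (simp add: qh_op_inv_def t_def c_def)
  moreover have "smult (- c) ((pderiv ^^ 2) (t k)) = - t (Suc k)" for k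
    by (simp add: t_def pderiv_smult numeral_2_eq_2)
  ultimately have "qh_op N y (qh_op_inv N y p) = (\<Sum>k\<le>degree p. t k - t (Suc k))"
    by (simp add: qh_op_def c_def numeral_2_eq_2 pderiv_sum' smult_sum' sum.distrib sum_negf
        sum_subtractf)
  also have "\<dots> = t 0 - t (Suc (degree p))"
    by (rule sum_telescope)
  also have "t (Suc (degree p)) = 0"
    unfolding t_def by (subst funpow_pderiv_eq_0) auto
  finally show ?thesis by (simp add: t_def)
qed

lemma qh_op_inv_qh_op: "qh_op_inv N y (qh_op N y p) = p"
proof -
  let ?q = "(pderiv ^^ 2) p"
  have d: "degree ?q \<le> degree p" by (simp add: numeral_2_eq_2 degree_pderiv)
  have "degree (qh_op N y p) \<le> degree p"
    unfolding qh_op_def using d by (intro degree_add_le) (auto intro: order_trans[OF degree_smult_le])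
  then have "qh_op_inv N y (qh_op N y p) = qh_op_inv N y p + smult (y / real N) (qh_op_inv N y ?q)"
    using d by (simp add: qh_op_inv_eq[of _ "degree p"] qh_op_def funpow_pderiv_add
        funpow_pderiv_smult smult_add_right sum.distrib smult_sum' mult.commute)
  also have "\<dots> = qh_op N y (qh_op_inv N y p)"
    by (simp add: qh_op_def numeral_2_eq_2 pderiv_qh_op_inv)
  finally show ?thesis by (simp add: qh_op_qh_op_inv)
qed

end

(*
  Write A = 1 + (y/N) D^2. Since [D^2, x] = 2 D, one has A (x p) = x (A p) + (2 y/N) (D p), and A
  commutes with D, so A^N (x p) = x (A^N p) + 2 y A^(N-1) (D p). Taking p = x^n gives the raising
  relation. The recurrence in n follows by applying this relation both to H_(n+1) and, on the
  right-hand side, to H_(n-1), and expanding H_(n-1) = A (A^(N-1) x^(n-1)).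
*)
theory Submission
  imports Defs
begin

lemma pderiv_monom_1: "pderiv (monom 1 n) = smult (real n) (monom 1 (n - 1))"
  by (simp add: pderiv_monom smult_monom)

lemma qh_op_add: "qh_op N y (p + q) = qh_op N y p + qh_op N y q"
  by (simp add: qh_op_def funpow_pderiv_add smult_add_right)

lemma qh_op_smult: "qh_op N y (smult c p) = smult c (qh_op N y p)"
  by (simp add: qh_op_def funpow_pderiv_smult smult_add_right mult.commute)

lemma funpow_qh_op_smult: "(qh_op N y ^^ m) (smult c p) = smult c ((qh_op N y ^^ m) p)"
  by (induction m) (simp_all add: qh_op_smult)

lemma pderiv_qh_op: "pderiv (qh_op N y p) = qh_op N y (pderiv p)"
  by (simp add: qh_op_def numeral_2_eq_2 pderiv_add pderiv_smult)

lemma pderiv_funpow_qh_op: "pderiv ((qh_op N y ^^ m) p) = (qh_op N y ^^ m) (pderiv p)"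
  by (induction m) (simp_all add: pderiv_qh_op)

lemma pderiv_funpow_qh_op_monom:
  "pderiv ((qh_op N y ^^ m) (monom 1 n)) = smult (real n) ((qh_op N y ^^ m) (monom 1 (n - 1)))"
  by (simp add: pderiv_funpow_qh_op pderiv_monom_1 funpow_qh_op_smult)

text \<open>\<open>pCons 0 p\<close> is x p, and the product rule gives D^2 (x p) = x D^2 p + 2 D
  p.\<close>

lemma qh_op_pCons_0: "qh_op N y (pCons 0 p) = pCons 0 (qh_op N y p) + smult (2 * y / real N) (pderiv p)"
proof -
  \<comment> \<open>Differentiating x p twice produces two separate copies of D p, so the
    coefficient is split to match.\<close>
  have "2 * y / real N = y / real N + y / real N" by simp
  then have "smult (2 * y / real N) (pderiv p) = smult (y / real N) (pderiv p) + smult (y / real N) (pderiv p)"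
    by (simp only: smult_add_left)
  then show ?thesis
    by (simp add: qh_op_def numeral_2_eq_2 pderiv_pCons pderiv_add smult_add_right)
qed

text \<open>Each factor A moved past x leaves one term (2 y/N) D p under the remaining m factors.
  The exponent \<open>Suc m\<close> avoids a truncated m - 1.\<close>

lemma funpow_Suc_qh_op_pCons_0:
  "(qh_op N y ^^ Suc m) (pCons 0 p)
     = pCons 0 ((qh_op N y ^^ Suc m) p)
       + smult (2 * y * real (Suc m) / real N) ((qh_op N y ^^ m) (pderiv p))"
proof (induction m)
  case 0
  show ?case by (simp add: qh_op_pCons_0)
next
  case (Suc m)
  have "(qh_op N y ^^ Suc (Suc m)) (pCons 0 p)
      = qh_op N y (pCons 0 ((qh_op N y ^^ Suc m) p)
          + smult (2 * y * real (Suc m) / real N) ((qh_op N y ^^ m) (pderiv p)))"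
    by (subst funpow.simps(2), unfold o_apply Suc.IH) (rule refl)
  also have "\<dots> = pCons 0 ((qh_op N y ^^ Suc (Suc m)) p)
      + (smult (2 * y / real N) ((qh_op N y ^^ Suc m) (pderiv p))
         + smult (2 * y * real (Suc m) / real N) ((qh_op N y ^^ Suc m) (pderiv p)))"
    by (simp only: qh_op_add qh_op_smult qh_op_pCons_0 pderiv_qh_op pderiv_funpow_qh_op add.assoc
        funpow.simps(2) o_apply)
  also have "\<dots> = pCons 0 ((qh_op N y ^^ Suc (Suc m)) p)
      + smult (2 * y * real (Suc (Suc m)) / real N) ((qh_op N y ^^ Suc m) (pderiv p))"
    by (simp add: algebra_simps add_divide_distrib flip: smult_add_left del: funpow.simps)
  finally show ?case .
qed

lemma pderiv_quasi_hermite: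
  "pderiv (quasi_hermite N y n) = smult (real n) (quasi_hermite N y (n - 1))"
  by (simp add: quasi_hermite_def pderiv_funpow_qh_op_monom)

text \<open>With N = \<open>Suc M\<close> factors the N commutator terms cancel the denominator N.
  At n = 0 the coefficient kills the term with the truncated index.\<close>

lemma quasi_hermite_Suc:
  "quasi_hermite (Suc M) y (Suc n)
     = pCons 0 (quasi_hermite (Suc M) y n)
       + smult (2 * y * real n) ((qh_op (Suc M) y ^^ M) (monom 1 (n - 1)))"
  unfolding quasi_hermite_def monom_Suc funpow_Suc_qh_op_pCons_0
  by (simp add: pderiv_monom_1 funpow_qh_op_smult del: funpow.simps of_nat_Suc)

lemma qh_op_inv_quasi_hermite:
  "qh_op_inv (Suc M) y (quasi_hermite (Suc M) y n) = (qh_op (Suc M) y ^^ M) (monom 1 n)"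
  by (simp add: quasi_hermite_def qh_op_inv_qh_op)

text \<open>The inverse removes one of the N factors, leaving A^(N-1) x^n, whose derivative is the
  extra term n A^(N-1) x^(n-1) of \<open>quasi_hermite_Suc\<close>.\<close>

lemma quasi_hermite_raising:
  assumes "N \<ge> 1"
  shows "quasi_hermite N y (Suc n)
    = pCons 0 (quasi_hermite N y n) + smult (2 * y) (pderiv (qh_op_inv N y (quasi_hermite N y n)))"
proof -
  obtain M where "N = Suc M" using assms by (cases N) auto
  then show ?thesis
    by (simp add: quasi_hermite_Suc qh_op_inv_quasi_hermite pderiv_funpow_qh_op_monom)
qed

text \<open>Only the outermost A is expanded; D^2 passes through the other factors and acts on
  x^n.\<close>

lemma quasi_hermite_eq_funpow:
  "quasi_hermite (Suc M) y n
     = (qh_op (Suc M) y ^^ M) (monom 1 n)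
       + smult (y / real (Suc M) * (real n * real (n - 1))) ((qh_op (Suc M) y ^^ M) (monom 1 (n - 2)))"
  by (simp add: quasi_hermite_def qh_op_def[of _ _ "(_ ^^ _) _"] numeral_2_eq_2
      pderiv_funpow_qh_op_monom pderiv_smult mult.assoc)

lemma quasi_hermite_recurrence:
  assumes "N \<ge> 1"
  shows "quasi_hermite N y (Suc n) - pCons 0 (quasi_hermite N y n)
      - smult (2 * real n * y) (quasi_hermite N y (n - 1))
    = smult (y / real N * (real n * (real n - 1)))
        (pCons 0 (quasi_hermite N y (n - 2)) - quasi_hermite N y (n - 1))"
proof -
  obtain M where N: "N = Suc M" using assms by (cases N) auto
  \<comment> \<open>Both sides are reduced to multiples of G(n-3), where G(k) = A^(N-1) x^k.\<close>
  let ?G = "\<lambda>k. (qh_op N y ^^ M) (monom 1 k)"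
  have "quasi_hermite N y (Suc n) - pCons 0 (quasi_hermite N y n)
      - smult (2 * real n * y) (quasi_hermite N y (n - 1))
    = smult (2 * y * real n) (?G (n - 1)) - smult (2 * real n * y) (quasi_hermite N y (n - 1))"
    by (simp add: N quasi_hermite_Suc)
  \<comment> \<open>Expanding H_(n-1) as G(n-1) plus a multiple of G(n-3) cancels the G(n-1)
    terms.\<close>
  also have "\<dots> = - smult (2 * y * real n * (y / real N * (real (n - 1) * real (n - 2)))) (?G (n - 3))"
    unfolding N quasi_hermite_eq_funpow[of M y "n - 1"]
    by (simp add: smult_add_right mult_ac numeral_3_eq_3 numeral_2_eq_2)
  also have "\<dots> = smult (y / real N * (real n * (real n - 1)))
      (pCons 0 (quasi_hermite N y (n - 2)) - quasi_hermite N y (n - 1))"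
  proof (cases "n \<ge> 2")
    case True
    then obtain k where n: "n = Suc (Suc k)" by (metis Suc_le_D numeral_2_eq_2 Suc_le_mono)
    \<comment> \<open>Here x H_k - H_(k+1) = -2 y k G(k-1) by \<open>quasi_hermite_Suc\<close>, and
      k - 1 = n - 3; for k = 0 both sides vanish.\<close>
    show ?thesis
      by (simp add: n N quasi_hermite_Suc mult_ac numeral_3_eq_3 del: of_nat_Suc)
         (simp add: algebra_simps)
  next
    case False
    \<comment> \<open>Both coefficients contain a zero factor in these cases, so the truncated
      indices do not matter.\<close>
    then have "n = 0 \<or> n = 1" by auto
    then show ?thesis by auto
  qed
  finally show ?thesis .
qed

theorem mainTheorem1:
  fixes N n :: nat and y :: real
  assumes "N \<ge> 1"
  shows
    "pderiv (quasi_hermite N y n) = smult (real n) ((qh_op N y ^^ N) (monom 1 (n - 1)))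
     \<and> smult (real n) ((qh_op N y ^^ N) (monom 1 (n - 1))) = smult (real n) (quasi_hermite N y (n - 1))
     \<and> quasi_hermite N y (n + 1)
         = [:0, 1:] * quasi_hermite N y n
           + smult (2 * y) (pderiv (qh_op_inv N y (quasi_hermite N y n)))
     \<and> quasi_hermite N y (n + 1) - [:0, 1:] * quasi_hermite N y n
           - smult (2 * real n * y) (quasi_hermite N y (n - 1))
         = smult (y / real N * (real n * (real n - 1)))
             ([:0, 1:] * quasi_hermite N y (n - 2) - quasi_hermite N y (n - 1))"
  using quasi_hermite_raising[OF assms] quasi_hermite_recurrence[OF assms]
  by (simp add: pderiv_quasi_hermite flip: quasi_hermite_def)

end
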